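(* Let $\Gamma_A=(A,\alpha)$ and $\Gamma_B=(B,\beta)$ be two normalized games, let $i\in A$, and let $\Gamma_C=\Gamma_A\circ_i\Gamma_B$. Then the Shapley value of $\Gamma_C$ is $$\phi_j(\Gamma_C)=\begin{cases}\displaystyle\sum_{\substack{S\subseteq A \\ S\ni i}}\ \sum_{\substack{T\subseteq B \\ T\ni j}}\frac{\mu^\alpha(S)\,\mu^\beta(T)}{|S\diamond_iT|}&\text{if }j\in B,\\[3ex]\displaystyle\phi_j(\Gamma_{A\setminus\{i\}})+\sum_{\substack{S\subseteq A \\ S\supseteq\{i,j\}}}\ \sum_{T\subseteq B}\frac{\mu^\alpha(S)\,\mu^\beta(T)}{|S\diamond_iT|}&\text{if }j\in A\setminus\{i\},\end{cases}$$ where $\Gamma_{A\setminus\{i\}}$ denotes the restriction of $\Gamma_A$ to the coalition $A\setminus\{i\}$.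
   Context: A game is a pair $\Gamma=(N,v)$, $N$ a finite totally ordered set of players, $v:\mathcal P(N)\to\mathbb R$ with $v(\emptyset)=0$; it is normalized if $v(N)=1$. Its Möbius transform is $\mu^v(S)=\sum_{T\subseteq S}(-1)^{|S\setminus T|}v(T)$. Its Shapley value is the vector $\phi(\Gamma)\in\mathbb R^N$ with $\phi_j(\Gamma)=\sum_{S\subseteq N,\,S\ni j}\mu^v(S)/|S|$. The restriction of $(N,v)$ to $M\subseteq N$ is $(M,v|_{\mathcal P(M)})$. For games $(A,\alpha)$, $(B,\beta)$ with disjoint player sets and $i\in A$, the game $(A,\alpha)\circ_i(B,\beta)$ has player set $A\diamond_iB=(A\setminus\{i\})\cup B$ and coalition function $$(\alpha\circ_i\beta)(S)=\beta(B)\alpha(S\cap A)+\partial_i\alpha(S\cap A)\,\beta(S\cap B),\qquad \partial_i\alpha(T)=\alpha(T\cup\{i\})-\alpha(T\setminus\{i\}).$$ For $S\subseteq A$ and $T\subseteq B$: $S\diamond_iT=(S\setminus\{i\})\cup T$ if $i\in S$, and $S\diamond_iT=S$ otherwise. *)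

theory Defs
  imports Complex_Main "HOL-Library.FuncSet"
begin

text \<open>
  A finite totally ordered set of players is a finite set of elements of a type of class
  \<^class>\<open>linorder\<close>. Only the values of the coalition function on subsets of the
  player set are meaningful.
\<close>

type_synonym 'a game = "'a set \<times> ('a set \<Rightarrow> real)"

abbreviation players :: "'a game \<Rightarrow> 'a set"
  where "players \<equiv> fst"

abbreviation worth :: "'a game \<Rightarrow> 'a set \<Rightarrow> real"
  where "worth \<equiv> snd"

definition game :: "('a::linorder) game \<Rightarrow> bool"
  where "game \<Gamma> \<longleftrightarrow> finite (players \<Gamma>) \<and> worth \<Gamma> {} = 0"

definition normalized :: "'a game \<Rightarrow> bool"
  where "normalized \<Gamma> \<longleftrightarrow> worth \<Gamma> (players \<Gamma>) = 1"

definition mobius :: "('a set \<Rightarrow> real) \<Rightarrow> 'a set \<Rightarrow> real"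
  where "mobius v S = (\<Sum>T\<in>Pow S. (- 1) ^ card (S - T) * v T)"

text \<open>Off the player set the value is an empty sum, hence zero.\<close>

definition shapley :: "'a game \<Rightarrow> 'a \<Rightarrow> real"
  where "shapley \<Gamma> j =
    (\<Sum>S | S \<subseteq> players \<Gamma> \<and> j \<in> S. mobius (worth \<Gamma>) S / real (card S))"

definition restrict_game :: "'a game \<Rightarrow> 'a set \<Rightarrow> 'a game"
  where "restrict_game \<Gamma> M = (M, restrict (worth \<Gamma>) (Pow M))"

definition marginal :: "'a \<Rightarrow> ('a set \<Rightarrow> real) \<Rightarrow> 'a set \<Rightarrow> real"
  where "marginal i v T = v (T \<union> {i}) - v (T - {i})"

definition diamond :: "'a set \<Rightarrow> 'a \<Rightarrow> 'a set \<Rightarrow> 'a set"  ("(_ \<diamondop>\<^bsub>_\<^esub> _)" [71, 0, 71] 70)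
  where "S \<diamondop>\<^bsub>i\<^esub> T = (if i \<in> S then (S - {i}) \<union> T else S)"

text \<open>
  The composition is meant for disjoint player sets and a player \<open>i\<close> of the first game,
  so that its player set is \<open>(A - {i}) \<union> B\<close>.
\<close>

definition compose_game :: "'a game \<Rightarrow> 'a \<Rightarrow> 'a game \<Rightarrow> 'a game"
    ("(_ \<circ>\<^bsub>_\<^esub> _)" [71, 0, 71] 70)
  where "\<Gamma> \<circ>\<^bsub>i\<^esub> \<Delta> =
    (let A = players \<Gamma>; \<alpha> = worth \<Gamma>; B = players \<Delta>; \<beta> = worth \<Delta> in
      (A \<diamondop>\<^bsub>i\<^esub> B,
       \<lambda>S\<in>Pow (A \<diamondop>\<^bsub>i\<^esub> B).
         \<beta> B * \<alpha> (S \<inter> A) + marginal i \<alpha> (S \<inter> A) * \<beta> (S \<inter> B)))"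

end

theory Submission
  imports Defs
begin

text \<open>
  The Shapley value is linear in the Moebius transform, so everything rests on computing the
  transform of the composed game. A coalition of the composed game splits uniquely as
  \<open>U \<union> T\<close> with \<open>U \<subseteq> A - {i}\<close> and \<open>T \<subseteq> B\<close>, and since \<open>\<beta> B = 1\<close> the composed game is worth
  \<open>\<alpha> U \<cdot> 1 + \<partial>\<^sub>i\<alpha> U \<cdot> \<beta> T\<close> there: a sum of two products of a function of \<open>U\<close> by a function
  of \<open>T\<close>. The Moebius transform turns such products into products of transforms
  (\<open>mobius_split\<close>). The transform of the constant \<open>1\<close> is concentrated on the empty set, and
  the transform of \<open>\<partial>\<^sub>i\<alpha>\<close> at \<open>U\<close> is the transform of \<open>\<alpha>\<close> at \<open>U \<union> {i}\<close>; both follow from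
  \<open>mobius_insert\<close>. Hence the composed game has the transform
  \<open>[T = {}] \<cdot> mobius \<alpha> U + mobius \<alpha> (U \<union> {i}) \<cdot> mobius \<beta> T\<close>
  at \<open>U \<union> T\<close> (\<open>mobius_compose\<close>).

  Now divide by \<open>card (U \<union> T)\<close>, which is the size of \<open>(U \<union> {i}) \<diamondop>\<^bsub>i\<^esub> T\<close>, and sum over the
  coalitions containing \<open>j\<close>. The second term gives the double sums of the theorem. The first
  term contributes only when \<open>T = {}\<close>: never if \<open>j \<in> B\<close>, and otherwise exactly the Shapley
  value of the first game restricted to \<open>A - {i}\<close>.
\<close>

lemma mobius_cong:
  assumes "\<And>T. T \<subseteq> S \<Longrightarrow> v T = w T"
  shows "mobius v S = mobius w S"
  unfolding mobius_def by (rule sum.cong) (auto simp: assms)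

lemma sum_split_union:
  fixes f :: "'a set \<Rightarrow> 'b::comm_monoid_add"
  assumes "A \<inter> B = {}" and "X \<subseteq> Pow A" and "Y \<subseteq> Pow B"
  shows "(\<Sum>S | S \<subseteq> A \<union> B \<and> S \<inter> A \<in> X \<and> S \<inter> B \<in> Y. f S) = (\<Sum>U\<in>X. \<Sum>T\<in>Y. f (U \<union> T))"
proof -
  have parts: "(U \<union> T) \<inter> A = U" "(U \<union> T) \<inter> B = T" "U \<union> T \<subseteq> A \<union> B" if "U \<in> X" "T \<in> Y" for U T
    using that assms by blast+
  have "(\<Sum>S | S \<subseteq> A \<union> B \<and> S \<inter> A \<in> X \<and> S \<inter> B \<in> Y. f S) = (\<Sum>(U, T)\<in>X \<times> Y. f (U \<union> T))"
  proof (rule sum.reindex_bij_witness[where i = "\<lambda>(U, T). U \<union> T" and j = "\<lambda>S. (S \<inter> A, S \<inter> B)"])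
    fix p assume "p \<in> X \<times> Y"
    then obtain U T where p: "p = (U, T)" "U \<in> X" "T \<in> Y" by auto
    show "((case p of (U, T) \<Rightarrow> U \<union> T) \<inter> A, (case p of (U, T) \<Rightarrow> U \<union> T) \<inter> B) = p"
      and "(case p of (U, T) \<Rightarrow> U \<union> T) \<in> {S. S \<subseteq> A \<union> B \<and> S \<inter> A \<in> X \<and> S \<inter> B \<in> Y}"
      unfolding p(1) prod.case mem_Collect_eq parts(1,2)[OF p(2,3)]
      using p parts(3) by blast+
  qed (auto simp: Int_Un_distrib[symmetric] Int_absorb2)
  then show ?thesis
    by (simp add: sum.cartesian_product)
qed

lemma sum_insert_image:
  assumes "\<And>U. U \<in> X \<Longrightarrow> i \<notin> U"
  shows "(\<Sum>S\<in>insert i ` X. f S) = (\<Sum>U\<in>X. f (insert i U))"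
proof -
  have "inj_on (insert i) X"
    using assms by (intro inj_onI) (metis insert_ident)
  then show ?thesis
    by (simp add: sum.reindex)
qed

text \<open>
  The set of subsets of \<open>U \<union> T\<close> is the product of the two power sets, and the sign
  is multiplicative along this decomposition.
\<close>

lemma mobius_split:
  assumes "finite U" and "finite T" and "U \<inter> T = {}"
    and v: "\<And>P Q. P \<subseteq> U \<Longrightarrow> Q \<subseteq> T \<Longrightarrow> v (P \<union> Q) = f P * g Q + h P * k Q"
  shows "mobius v (U \<union> T) = mobius f U * mobius g T + mobius h U * mobius k T"
proof -
  have sign: "(- 1 :: real) ^ card (U \<union> T - (P \<union> Q)) = (- 1) ^ card (U - P) * (- 1) ^ card (T - Q)"
    if "P \<subseteq> U" "Q \<subseteq> T" for P Q
  proof -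
    have "U \<union> T - (P \<union> Q) = (U - P) \<union> (T - Q)"
      using that assms(3) by blast
    moreover have "card ((U - P) \<union> (T - Q)) = card (U - P) + card (T - Q)"
      using assms(1-3) by (intro card_Un_disjoint) auto
    ultimately show ?thesis
      by (simp add: power_add)
  qed
  have "Pow (U \<union> T) = {S. S \<subseteq> U \<union> T \<and> S \<inter> U \<in> Pow U \<and> S \<inter> T \<in> Pow T}"
    by auto
  then have "mobius v (U \<union> T) =
      (\<Sum>P\<in>Pow U. \<Sum>Q\<in>Pow T. (- 1) ^ card (U \<union> T - (P \<union> Q)) * v (P \<union> Q))"
    unfolding mobius_def using sum_split_union[OF assms(3), of "Pow U" "Pow T"] by simp
  also have "\<dots> = (\<Sum>P\<in>Pow U. \<Sum>Q\<in>Pow T.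
      ((- 1) ^ card (U - P) * f P) * ((- 1) ^ card (T - Q) * g Q) +
      ((- 1) ^ card (U - P) * h P) * ((- 1) ^ card (T - Q) * k Q))"
    by (intro sum.cong refl) (simp add: sign v algebra_simps)
  finally show ?thesis
    by (simp add: mobius_def sum.distrib sum_product)
qed

text \<open>
  Pairing the subsets of \<open>insert i U\<close> that differ only in \<open>i\<close>, with opposite signs, turns
  values into differences.
\<close>

lemma mobius_insert:
  assumes "finite U" and "i \<notin> U"
  shows "mobius v (insert i U) = mobius (\<lambda>P. v (insert i P) - v P) U"
proof -
  have "(\<Sum>T\<in>Pow (insert i U). (- 1) ^ card (insert i U - T) * v T) =
      (\<Sum>P\<in>Pow U. (- 1) ^ card (insert i U - P) * v P) +
      (\<Sum>T\<in>insert i ` Pow U. (- 1) ^ card (insert i U - T) * v T)"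
    unfolding Pow_insert using assms by (intro sum.union_disjoint) auto
  also have "\<dots> = (\<Sum>P\<in>Pow U. (- 1) ^ card (insert i U - P) * v P) +
      (\<Sum>P\<in>Pow U. (- 1) ^ card (insert i U - insert i P) * v (insert i P))"
    using assms by (subst sum_insert_image) auto
  also have "\<dots> = (\<Sum>P\<in>Pow U. (- 1) ^ card (U - P) * (v (insert i P) - v P))"
    unfolding sum.distrib[symmetric]
  proof (rule sum.cong)
    fix P assume "P \<in> Pow U"
    then have "insert i U - P = insert i (U - P)" "insert i U - insert i P = U - P"
      using assms by auto
    then show "(- 1) ^ card (insert i U - P) * v P +
        (- 1) ^ card (insert i U - insert i P) * v (insert i P) =
        (- 1) ^ card (U - P) * (v (insert i P) - v P)"
      using assms by (simp add: algebra_simps)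
  qed simp
  finally show ?thesis
    by (simp add: mobius_def)
qed

lemma mobius_const:
  assumes "finite T"
  shows "mobius (\<lambda>_. c) T = (if T = {} then c else 0)"
proof (cases "T = {}")
  case True
  then show ?thesis by (simp add: mobius_def)
next
  case False
  then obtain x T' where T': "T = insert x T'" "x \<notin> T'"
    by (meson Set.set_insert ex_in_conv)
  with assms have "mobius (\<lambda>_. c) T = mobius (\<lambda>_. 0) T'"
    by (simp add: mobius_insert)
  with False show ?thesis
    by (simp add: mobius_def)
qed

lemma mobius_compose:
  assumes "finite A" and "finite B" and "A \<inter> B = {}" and "i \<in> A" and "\<beta> B = 1"
    and U: "U \<subseteq> A - {i}" and T: "T \<subseteq> B"
  shows "mobius (worth ((A, \<alpha>) \<circ>\<^bsub>i\<^esub> (B, \<beta>))) (U \<union> T) =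
    (if T = {} then mobius \<alpha> U else 0) + mobius \<alpha> (insert i U) * mobius \<beta> T"
proof -
  have fin: "finite U" "finite T" and disj: "U \<inter> T = {}" and i: "i \<notin> U"
    using assms by (auto intro: finite_subset)
  have "worth ((A, \<alpha>) \<circ>\<^bsub>i\<^esub> (B, \<beta>)) (P \<union> Q) = \<alpha> P * 1 + (\<alpha> (insert i P) - \<alpha> P) * \<beta> Q"
    if "P \<subseteq> U" "Q \<subseteq> T" for P Q
  proof -
    have "(P \<union> Q) \<inter> A = P" "(P \<union> Q) \<inter> B = Q" "i \<notin> P" "P \<union> Q \<subseteq> A - {i} \<union> B"
      using that assms by auto
    then show ?thesis
      using assms(4,5) by (simp add: compose_game_def diamond_def marginal_def)
  qed
  then have "mobius (worth ((A, \<alpha>) \<circ>\<^bsub>i\<^esub> (B, \<beta>))) (U \<union> T) =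
      mobius \<alpha> U * mobius (\<lambda>_. 1) T + mobius (\<lambda>P. \<alpha> (insert i P) - \<alpha> P) U * mobius \<beta> T"
    by (rule mobius_split[OF fin disj])
  then show ?thesis
    using fin i by (simp add: mobius_const mobius_insert)
qed

theorem proposition17:
  fixes A B :: "('a::linorder) set"
    and \<alpha> \<beta> :: "'a set \<Rightarrow> real"
    and i :: 'a
    and \<Gamma>\<^sub>C :: "'a game"
  assumes "game (A, \<alpha>)" and "normalized (A, \<alpha>)"
    and "game (B, \<beta>)" and "normalized (B, \<beta>)"
    and "A \<inter> B = {}"
    and "i \<in> A"
    and "\<Gamma>\<^sub>C = (A, \<alpha>) \<circ>\<^bsub>i\<^esub> (B, \<beta>)"
  shows "\<forall>j \<in> players \<Gamma>\<^sub>C.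
      (j \<in> B \<longrightarrow>
        shapley \<Gamma>\<^sub>C j =
          (\<Sum>S | S \<subseteq> A \<and> i \<in> S. \<Sum>T | T \<subseteq> B \<and> j \<in> T.
            mobius \<alpha> S * mobius \<beta> T / real (card (S \<diamondop>\<^bsub>i\<^esub> T)))) \<and>
      (j \<in> A - {i} \<longrightarrow>
        shapley \<Gamma>\<^sub>C j =
          shapley (restrict_game (A, \<alpha>) (A - {i})) j +
          (\<Sum>S | S \<subseteq> A \<and> {i, j} \<subseteq> S. \<Sum>T | T \<subseteq> B.
            mobius \<alpha> S * mobius \<beta> T / real (card (S \<diamondop>\<^bsub>i\<^esub> T))))"
proof -
  have finA: "finite A" and finB: "finite B" and \<beta>B: "\<beta> B = 1"
    using assms by (auto simp: game_def normalized_def)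
  let ?A = "A - {i}"
  have disj: "?A \<inter> B = {}"
    using assms(5) by blast
  have players: "players \<Gamma>\<^sub>C = ?A \<union> B"
    using assms(6,7) by (simp add: compose_game_def diamond_def)
  note mobius_C = mobius_compose[where \<alpha> = \<alpha> and \<beta> = \<beta>, OF finA finB assms(5,6) \<beta>B, folded assms(7)]
  \<comment> \<open>A coalition \<open>U\<close> without \<open>i\<close> stands for the coalition \<open>insert i U\<close> of the first game.\<close>
  have diamond: "insert i U \<diamondop>\<^bsub>i\<^esub> T = U \<union> T" if "U \<subseteq> ?A" for U T
    using that by (auto simp: diamond_def)
  have case_B: "shapley \<Gamma>\<^sub>C j =
      (\<Sum>S | S \<subseteq> A \<and> i \<in> S. \<Sum>T | T \<subseteq> B \<and> j \<in> T.
        mobius \<alpha> S * mobius \<beta> T / real (card (S \<diamondop>\<^bsub>i\<^esub> T)))" if j: "j \<in> B" for j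
  proof -
    let ?Y = "{T. T \<subseteq> B \<and> j \<in> T}"
    have "{S. S \<subseteq> players \<Gamma>\<^sub>C \<and> j \<in> S} = {S. S \<subseteq> ?A \<union> B \<and> S \<inter> ?A \<in> Pow ?A \<and> S \<inter> B \<in> ?Y}"
      using j players by auto
    then have "shapley \<Gamma>\<^sub>C j =
        (\<Sum>U\<in>Pow ?A. \<Sum>T\<in>?Y. mobius (worth \<Gamma>\<^sub>C) (U \<union> T) / real (card (U \<union> T)))"
      unfolding shapley_def using sum_split_union[OF disj, of "Pow ?A" ?Y] by auto
    also have "\<dots> = (\<Sum>U\<in>Pow ?A. \<Sum>T\<in>?Y.
        mobius \<alpha> (insert i U) * mobius \<beta> T / real (card (insert i U \<diamondop>\<^bsub>i\<^esub> T)))"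
      by (intro sum.cong refl) (auto simp: mobius_C diamond)
    also have "\<dots> = (\<Sum>S\<in>insert i ` Pow ?A. \<Sum>T\<in>?Y.
        mobius \<alpha> S * mobius \<beta> T / real (card (S \<diamondop>\<^bsub>i\<^esub> T)))"
      by (rule sum_insert_image[symmetric]) auto
    also have "insert i ` Pow ?A = {S. S \<subseteq> A \<and> i \<in> S}"
    proof -
      have "S \<in> insert i ` Pow ?A" if "S \<subseteq> A" "i \<in> S" for S
        by (rule image_eqI[of _ _ "S - {i}"]) (use that in auto)
      then show ?thesis using assms(6) by auto
    qed
    finally show ?thesis .
  qed
  have case_A: "shapley \<Gamma>\<^sub>C j = shapley (restrict_game (A, \<alpha>) ?A) j +
      (\<Sum>S | S \<subseteq> A \<and> {i, j} \<subseteq> S. \<Sum>T | T \<subseteq> B.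
        mobius \<alpha> S * mobius \<beta> T / real (card (S \<diamondop>\<^bsub>i\<^esub> T)))" if j: "j \<in> ?A" for j
  proof -
    let ?X = "{U. U \<subseteq> ?A \<and> j \<in> U}"
    have restricted: "shapley (restrict_game (A, \<alpha>) ?A) j = (\<Sum>U\<in>?X. mobius \<alpha> U / real (card U))"
    proof -
      have "mobius (restrict \<alpha> (Pow ?A)) U = mobius \<alpha> U" if "U \<subseteq> ?A" for U
        by (rule mobius_cong) (use that in \<open>simp add: restrict_def; blast\<close>)
      then show ?thesis
        by (simp add: shapley_def restrict_game_def)
    qed
    have "{S. S \<subseteq> players \<Gamma>\<^sub>C \<and> j \<in> S} = {S. S \<subseteq> ?A \<union> B \<and> S \<inter> ?A \<in> ?X \<and> S \<inter> B \<in> Pow B}"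
      using j players by auto
    then have "shapley \<Gamma>\<^sub>C j =
        (\<Sum>U\<in>?X. \<Sum>T\<in>Pow B. mobius (worth \<Gamma>\<^sub>C) (U \<union> T) / real (card (U \<union> T)))"
      unfolding shapley_def using sum_split_union[OF disj, of ?X "Pow B"] by auto
    also have "\<dots> = (\<Sum>U\<in>?X. \<Sum>T\<in>Pow B. (if T = {} then mobius \<alpha> U / real (card U) else 0) +
        mobius \<alpha> (insert i U) * mobius \<beta> T / real (card (insert i U \<diamondop>\<^bsub>i\<^esub> T)))"
      by (intro sum.cong refl) (auto simp: mobius_C diamond add_divide_distrib)
    also have "\<dots> = (\<Sum>U\<in>?X. mobius \<alpha> U / real (card U)) + (\<Sum>U\<in>?X. \<Sum>T\<in>Pow B.
        mobius \<alpha> (insert i U) * mobius \<beta> T / real (card (insert i U \<diamondop>\<^bsub>i\<^esub> T)))"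
      using finB by (simp add: sum.distrib)
    also have "(\<Sum>U\<in>?X. \<Sum>T\<in>Pow B.
          mobius \<alpha> (insert i U) * mobius \<beta> T / real (card (insert i U \<diamondop>\<^bsub>i\<^esub> T))) =
        (\<Sum>S\<in>insert i ` ?X. \<Sum>T\<in>Pow B. mobius \<alpha> S * mobius \<beta> T / real (card (S \<diamondop>\<^bsub>i\<^esub> T)))"
      by (rule sum_insert_image[symmetric]) auto
    also have "insert i ` ?X = {S. S \<subseteq> A \<and> {i, j} \<subseteq> S}"
    proof -
      have "S \<in> insert i ` ?X" if "S \<subseteq> A" "{i, j} \<subseteq> S" for S
        by (rule image_eqI[of _ _ "S - {i}"]) (use that j in auto)
      then show ?thesis using assms(6) by auto
    qed
    finally show ?thesis
      by (simp add: restricted Pow_def)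
  qed
  show ?thesis
    using case_A case_B by blast
qed

end
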